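(* Let $(X_j)_{j\geq 1}$ be a stationary, square integrable, $\alpha$-mixing sequence of real-valued random variables on a probability space $(\Omega,\mathcal{A},\mathbb{P})$, with common cumulative distribution function $F$ and mixing coefficients $\alpha(n)$, $n\ge1$. Suppose that for some $\delta\in(0,1)$, $$\alpha(n)=O\left(n^{-\frac{1+\delta}{1-\delta}}\right)\quad\text{as } n\to+\infty.$$ Then $$\sup_{x\in\mathbb{R}}|F_n(x)-F(x)|\rightarrow 0\quad\text{almost surely, as } n\rightarrow+\infty.$$
   Context: For $n\ge 1$, $F_n(x)=\frac{1}{n}\sum_{i=1}^{n}\mathbb{I}_{\{X_i\leq x\}}$, $x\in\mathbb{R}$, is the empirical function, and $F(x)=\mathbb{P}(X_1\leq x)$. For two sub-$\sigma$-algebras $\mathcal{A}_1,\mathcal{A}_2$ of $\mathcal{A}$, set $\alpha(\mathcal{A}_1,\mathcal{A}_2)=\sup\{|\mathbb{P}(A)\mathbb{P}(B)-\mathbb{P}(A\cap B)| : A\in\mathcal{A}_1,\ B\in\mathcal{A}_2\}$. Let $\mathcal{F}_j^{\ell}$ denote the $\sigma$-algebra generated by $(X_i,\ j\leq i\leq\ell)$ (with $\ell=\infty$ allowed). The strong mixing coefficient of the sequence is $\alpha(n)=\sup\{\alpha(\mathcal{F}_1^{k},\mathcal{F}_{n+k}^{\infty}) : k\in\mathbb{N}^*\}$, and the sequence is called $\alpha$-mixing if $\alpha(n)\to 0$ as $n\to+\infty$. Square integrable means $\mathbb{E}X_j^2<+\infty$. *)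

theory Defs
  imports "HOL-Probability.Probability" "HOL-Library.Landau_Symbols"
begin

text \<open>
  Processes \<open>(X\<^sub>j)\<close> with \<open>j \<ge> 1\<close> are functions on \<open>nat\<close>; the value at index \<open>0\<close> is never used.
\<close>

text \<open>Strict stationarity: invariance of all finite-dimensional distributions under time shifts.\<close>

definition stationary_process :: "'a measure \<Rightarrow> (nat \<Rightarrow> 'a \<Rightarrow> real) \<Rightarrow> bool" where
  "stationary_process M X \<longleftrightarrow>
     (\<forall>J h. finite J \<and> J \<subseteq> {1..} \<longrightarrow>
        distr M (PiM J (\<lambda>_. borel)) (\<lambda>\<omega>. \<lambda>j\<in>J. X (j + h) \<omega>) =
        distr M (PiM J (\<lambda>_. borel)) (\<lambda>\<omega>. \<lambda>j\<in>J. X j \<omega>))"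

definition generated_sigma :: "'a measure \<Rightarrow> (nat \<Rightarrow> 'a \<Rightarrow> real) \<Rightarrow> nat set \<Rightarrow> 'a set set" where
  "generated_sigma M X I =
     sigma_sets (space M) (\<Union>i\<in>I. {X i -` B \<inter> space M | B. B \<in> sets borel})"

text \<open>
  On a probability space the suprema below range over nonempty subsets of \<open>{0..1}\<close>, so the
  real-valued \<open>SUP\<close> is the genuine supremum.
\<close>

definition alpha_coeff :: "'a measure \<Rightarrow> 'a set set \<Rightarrow> 'a set set \<Rightarrow> real" where
  "alpha_coeff M \<A> \<B> =
     (SUP (A, B)\<in>\<A> \<times> \<B>. \<bar>measure M A * measure M B - measure M (A \<inter> B)\<bar>)"

definition strong_mixing_coeff :: "'a measure \<Rightarrow> (nat \<Rightarrow> 'a \<Rightarrow> real) \<Rightarrow> nat \<Rightarrow> real" where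
  "strong_mixing_coeff M X n =
     (SUP k\<in>{1..}. alpha_coeff M (generated_sigma M X {1..k}) (generated_sigma M X {n + k..}))"

definition alpha_mixing :: "'a measure \<Rightarrow> (nat \<Rightarrow> 'a \<Rightarrow> real) \<Rightarrow> bool" where
  "alpha_mixing M X \<longleftrightarrow> strong_mixing_coeff M X \<longlonglongrightarrow> 0"

definition empirical_cdf :: "(nat \<Rightarrow> 'a \<Rightarrow> real) \<Rightarrow> nat \<Rightarrow> 'a \<Rightarrow> real \<Rightarrow> real" where
  "empirical_cdf X n \<omega> x = (\<Sum>i=1..n. indicator {..x} (X i \<omega>)) / real n"

end

theory Submission
  imports Defs "HOL-Library.Discrete_Functions"
begin

text \<open>
  The mixing exponent \<open>(1 + \<delta>) / (1 - \<delta>)\<close> exceeds \<open>1\<close>, so the mixing coefficients are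
  summable. For a Borel set \<open>A\<close>, the covariance of the indicators of \<open>X\<^sub>i \<in> A\<close> and \<open>X\<^sub>j \<in> A\<close> with
  \<open>i < j\<close> is at most \<open>\<alpha>(j - i)\<close>, since the two events lie in the past up to time \<open>i\<close> and in the
  future from time \<open>j\<close>. Summability therefore bounds the variance of the number of visits to
  \<open>A\<close> up to time \<open>n\<close> by a constant times \<open>n\<close> (lemma \<open>variance_partial_sum_le\<close>).

  A linear variance bound already gives a strong law for bounded variables
  (\<open>strong_law_if_variance_linear\<close>): at the times \<open>n = k\<^sup>2\<close> the second moments of the averages are
  \<open>O(1 / k\<^sup>2)\<close>, hence summable, so the averages tend to \<open>0\<close> almost surely along the squares; between
  \<open>k\<^sup>2\<close> and \<open>(k + 1)\<^sup>2\<close> a sum of bounded terms moves by \<open>O(k)\<close> only, which is negligible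
  against \<open>k\<^sup>2\<close>. By stationarity all the indicators have the same mean, and so for each \<open>A\<close> the
  empirical frequency of \<open>A\<close> converges almost surely to the probability of \<open>A\<close>
  (\<open>strong_law_frequency\<close>).

  Passing from each fixed \<open>A\<close> to a supremum over all \<open>x\<close> is the classical Glivenko-Cantelli
  argument, carried out for a single \<open>\<omega>\<close> in \<open>uniform_convergence_from_quantiles\<close>. Off a null set
  the frequencies converge on the closed and the open left rays ending at each of the countably
  many rational quantiles of \<open>F\<close>, and monotonicity controls every other \<open>x\<close> from its neighbouring
  quantiles. Open rays are needed because \<open>F\<close> may jump at a quantile: the left limit of \<open>F\<close>
  there, and not its value, is close to \<open>F x\<close> for \<open>x\<close> just below.
\<close>

section \<open>From convergence at quantiles to uniform convergence\<close>

text \<open>Allowing any set in place of the ray \<open>{..x}\<close> treats the empirical distribution function and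
  its left limits at once.\<close>

definition frequency :: "(nat \<Rightarrow> 'a \<Rightarrow> real) \<Rightarrow> nat \<Rightarrow> 'a \<Rightarrow> real set \<Rightarrow> real" where
  "frequency X n \<omega> A = (\<Sum>i=1..n. indicator A (X i \<omega>)) / real n"

lemma frequency_nonneg: "0 \<le> frequency X n \<omega> A"
  unfolding frequency_def by (intro divide_nonneg_nonneg sum_nonneg) auto

lemma frequency_le_1: "frequency X n \<omega> A \<le> 1"
proof -
  have "(\<Sum>i=1..n. indicator A (X i \<omega>) :: real) \<le> (\<Sum>i=1..n. 1)"
    by (intro sum_mono) (auto simp: indicator_def)
  thus ?thesis
    by (cases "n = 0") (auto simp: frequency_def field_simps)
qed

lemma frequency_mono: "A \<subseteq> B \<Longrightarrow> frequency X n \<omega> A \<le> frequency X n \<omega> B"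
  unfolding frequency_def by (intro divide_right_mono sum_mono) (auto simp: indicator_def)

text \<open>Every point left of the \<open>t\<close>-quantile has a value of the distribution function below \<open>t\<close>,
  and the measure of the open ray is the left limit of these values.\<close>

lemma (in cdf_distribution) measure_lessThan_quantile_le:
  assumes "0 < t" "t < 1"
  shows "measure M {..<I t} \<le> t"
proof (rule tendsto_upperbound[OF cdf_at_left])
  show "\<forall>\<^sub>F x in at_left (I t). C x \<le> t"
    unfolding eventually_at_filter
  proof (intro always_eventually allI impI)
    fix x assume "x \<in> {..<I t}"
    thus "C x \<le> t"
      using pseudoinverse[OF assms, of x] by simp
  qed
qed auto

text \<open>
  The quantiles at the levels \<open>k / m\<close> cut the line into pieces on which \<open>C\<close> grows by at most
  \<open>1 / m\<close>, disregarding jumps at the cut points. If \<open>x\<close> lies in the piece from the \<open>k\<close>-th cut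
  point up to, but not including, the next one, then \<open>\<nu> n {..x}\<close> lies between the value of
  \<open>\<nu> n\<close> on the closed ray at the former and its value on the open ray at the latter. These two
  values converge, uniformly over the finitely many \<open>k\<close>; the limit of the first is at least
  \<open>k / m\<close>, that of the second at most \<open>(k + 1) / m\<close>, while \<open>C x\<close> itself lies between these
  levels. At the two ends the bounds \<open>0\<close> and \<open>1\<close> replace the missing cut points.
\<close>

lemma (in cdf_distribution) uniform_convergence_from_quantiles:
  fixes \<nu> :: "nat \<Rightarrow> real set \<Rightarrow> real"
  assumes nonneg: "\<And>n A. 0 \<le> \<nu> n A"
    and le_1: "\<And>n A. \<nu> n A \<le> 1"
    and mono: "\<And>n A B. A \<subseteq> B \<Longrightarrow> \<nu> n A \<le> \<nu> n B"
    and closed_ray: "\<And>t. \<lbrakk>t \<in> \<rat>; 0 < t; t < 1\<rbrakk> \<Longrightarrow> (\<lambda>n. \<nu> n {..I t}) \<longlonglongrightarrow> measure M {..I t}"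
    and open_ray: "\<And>t. \<lbrakk>t \<in> \<rat>; 0 < t; t < 1\<rbrakk> \<Longrightarrow> (\<lambda>n. \<nu> n {..<I t}) \<longlonglongrightarrow> measure M {..<I t}"
  shows "(\<lambda>n. SUP x. \<bar>\<nu> n {..x} - C x\<bar>) \<longlonglongrightarrow> 0"
proof (rule LIMSEQ_I)
  fix r :: real assume "r > 0"
  obtain m :: nat where m: "m > 0" "1 / real m < r / 3"
    using reals_Archimedean[of "r / 3"] \<open>r > 0\<close>
    by (metis divide_pos_pos inverse_eq_divide zero_less_Suc zero_less_numeral)
  define q where "q k = I (real k / real m)" for k
  have ev: "\<forall>\<^sub>F n in sequentially. \<forall>k\<in>{1..<m}.
       \<bar>\<nu> n {..q k} - measure M {..q k}\<bar> < r / 3 \<and> \<bar>\<nu> n {..<q k} - measure M {..<q k}\<bar> < r / 3"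
  proof (intro eventually_ball_finite ballI eventually_conj)
    fix k assume "k \<in> {1..<m}"
    hence k: "real k / real m \<in> \<rat>" "0 < real k / real m" "real k / real m < 1"
      by auto
    show "\<forall>\<^sub>F n in sequentially. \<bar>\<nu> n {..q k} - measure M {..q k}\<bar> < r / 3"
      using tendstoD[OF closed_ray[OF k], of "r / 3"] \<open>r > 0\<close> by (simp add: q_def dist_real_def)
    show "\<forall>\<^sub>F n in sequentially. \<bar>\<nu> n {..<q k} - measure M {..<q k}\<bar> < r / 3"
      using tendstoD[OF open_ray[OF k], of "r / 3"] \<open>r > 0\<close> by (simp add: q_def dist_real_def)
  qed auto
  have "\<bar>(SUP x. \<bar>\<nu> n {..x} - C x\<bar>) - 0\<bar> < r"
    if n: "\<forall>k\<in>{1..<m}. \<bar>\<nu> n {..q k} - measure M {..q k}\<bar> < r / 3 \<and>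
                        \<bar>\<nu> n {..<q k} - measure M {..<q k}\<bar> < r / 3" for n
  proof -
    have bound: "\<bar>\<nu> n {..x} - C x\<bar> \<le> 2 * r / 3" for x
    proof -
      \<comment> \<open>Without the cap \<open>C x = 1\<close> would give \<open>k = m\<close>, and the level \<open>1\<close> need not have a
          quantile.\<close>
      define k where "k = min (nat \<lfloor>real m * C x\<rfloor>) (m - 1)"
      have "real (nat \<lfloor>real m * C x\<rfloor>) = of_int \<lfloor>real m * C x\<rfloor>"
        using cdf_nonneg[of x] by simp
      hence floor: "real (nat \<lfloor>real m * C x\<rfloor>) \<le> real m * C x"
                   "real m * C x < real (nat \<lfloor>real m * C x\<rfloor>) + 1"
        by linarith+
      have "k < m"
        using m(1) by (auto simp: k_def)
      have "real k \<le> real m * C x"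
        using floor(1) by (simp add: k_def)
      moreover have strict: "real m * C x < real (Suc k)" if "Suc k < m"
        using that floor(2) by (auto simp: k_def min_def split: if_splits)
      moreover have "real m * C x \<le> real (Suc k)"
      proof (cases "Suc k < m")
        case False
        hence "Suc k = m" using \<open>k < m\<close> by simp
        thus ?thesis using cdf_bounded_prob[of x] by (simp add: mult_left_le)
      qed (use strict in simp)
      ultimately have k: "real k / real m \<le> C x" "C x \<le> real (Suc k) / real m"
          "Suc k < m \<Longrightarrow> C x < real (Suc k) / real m"
        using m(1) by (auto simp: field_simps)
      have Suc_k: "real (Suc k) / real m = real k / real m + 1 / real m"
        by (simp add: add_divide_distrib)
      have lower: "C x - 2 * r / 3 \<le> \<nu> n {..x}"
      proof (cases "k = 0")
        case False
        hence "k \<in> {1..<m}" and t: "0 < real k / real m" "real k / real m < 1"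
          using \<open>k < m\<close> by auto
        have "q k \<le> x"
          using pseudoinverse[of "real k / real m" x] t k by (auto simp: q_def)
        have "real k / real m \<le> measure M {..q k}"
          using pseudoinverse[of "real k / real m" "q k"] t by (auto simp: q_def cdf_def)
        also have "\<dots> \<le> \<nu> n {..q k} + r / 3"
          using bspec[OF n \<open>k \<in> {1..<m}\<close>] by linarith
        also have "\<nu> n {..q k} \<le> \<nu> n {..x}"
          using \<open>q k \<le> x\<close> by (intro mono) auto
        finally show ?thesis
          using k(2) m(2) Suc_k by linarith
      next
        case True
        thus ?thesis using nonneg[of n "{..x}"] k(2) m(2) \<open>r > 0\<close> by simp
      qed
      have upper: "\<nu> n {..x} \<le> C x + 2 * r / 3"
      proof (cases "Suc k < m")
        case True
        hence "Suc k \<in> {1..<m}" and t: "0 < real (Suc k) / real m" "real (Suc k) / real m < 1"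
          by auto
        have "x < q (Suc k)"
          using pseudoinverse[OF t, of x] k(3)[OF True] unfolding q_def by linarith
        hence "\<nu> n {..x} \<le> \<nu> n {..<q (Suc k)}"
          by (intro mono) auto
        also have "\<dots> \<le> measure M {..<q (Suc k)} + r / 3"
          using bspec[OF n \<open>Suc k \<in> {1..<m}\<close>] by linarith
        also have "measure M {..<q (Suc k)} \<le> real (Suc k) / real m"
          using measure_lessThan_quantile_le[OF t] by (simp add: q_def)
        finally show ?thesis
          using k(1) m(2) Suc_k by linarith
      next
        case False
        hence "1 \<le> real (Suc k) / real m"
          using m(1) by (simp add: field_simps)
        thus ?thesis
          using le_1[of n "{..x}"] k(1) m(2) Suc_k \<open>r > 0\<close> by linarith
      qed
      show ?thesis using lower upper by linarith
    qed
    have "(SUP x. \<bar>\<nu> n {..x} - C x\<bar>) \<le> 2 * r / 3"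
      by (intro cSUP_least bound) auto
    moreover have "0 \<le> (SUP x. \<bar>\<nu> n {..x} - C x\<bar>)"
      by (rule cSUP_upper2[of _ _ 0]) (auto intro!: bdd_aboveI2 bound)
    ultimately show ?thesis using \<open>r > 0\<close> by simp
  qed
  with ev have "\<forall>\<^sub>F n in sequentially. norm ((SUP x. \<bar>\<nu> n {..x} - C x\<bar>) - 0) < r"
    by (auto elim: eventually_mono)
  thus "\<exists>n0. \<forall>n\<ge>n0. norm ((SUP x. \<bar>\<nu> n {..x} - C x\<bar>) - 0) < r"
    by (auto simp: eventually_at_top_linorder)
qed

section \<open>A strong law from a linear variance bound\<close>

text \<open>For \<open>k\<^sup>2 \<le> n < (k + 1)\<^sup>2\<close> the sums up to \<open>n\<close> and up to \<open>k\<^sup>2\<close> differ by at most \<open>2 * k\<close>, so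
  the averages differ by \<open>O(1 / k)\<close>.\<close>

lemma averages_converge_if_along_squares:
  fixes y :: "nat \<Rightarrow> real"
  assumes bounded: "\<And>i. \<bar>y i\<bar> \<le> 1"
    and squares: "(\<lambda>k. (\<Sum>i=1..k\<^sup>2. y i) / real (k\<^sup>2)) \<longlonglongrightarrow> 0"
  shows "(\<lambda>n. (\<Sum>i=1..n. y i) / real n) \<longlonglongrightarrow> 0"
proof (rule Lim_null_comparison)
  define s where "s n = (\<Sum>i=1..n. y i)" for n
  define b where "b k = \<bar>s (k\<^sup>2) / real (k\<^sup>2)\<bar> + 2 / real k" for k
  have "b \<longlonglongrightarrow> 0 + 0"
    unfolding b_def
    using squares unfolding s_def[symmetric]
    by (intro tendsto_add tendsto_rabs_zero lim_const_over_n)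
  moreover have "filterlim floor_sqrt at_top at_top"
    unfolding filterlim_at_top
    by (metis eventually_at_top_linorder le_floor_sqrtI)
  ultimately show "(\<lambda>n. b (floor_sqrt n)) \<longlonglongrightarrow> 0"
    using filterlim_compose[of b "nhds 0" at_top floor_sqrt] by simp
  show "\<forall>\<^sub>F n in sequentially. norm ((\<Sum>i=1..n. y i) / real n) \<le> b (floor_sqrt n)"
    using eventually_gt_at_top[of 0]
  proof eventually_elim
    case (elim n)
    define k where "k = floor_sqrt n"
    have "k > 0" "k\<^sup>2 \<le> n" "n < (Suc k)\<^sup>2"
      using elim Suc_floor_sqrt_power2_gt[of n] by (auto simp: k_def)
    hence "n - k\<^sup>2 \<le> 2 * k"
      by (auto simp: power2_eq_square)
    have "s n = s (k\<^sup>2) + (\<Sum>i=k\<^sup>2+1..n. y i)"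
      unfolding s_def using \<open>k\<^sup>2 \<le> n\<close> sum.ub_add_nat[of 1 "k\<^sup>2" y "n - k\<^sup>2"] by simp
    moreover have "\<bar>\<Sum>i=k\<^sup>2+1..n. y i\<bar> \<le> (\<Sum>i=k\<^sup>2+1..n. 1)"
      by (intro order.trans[OF sum_abs] sum_mono bounded)
    ultimately have "\<bar>s n\<bar> \<le> \<bar>s (k\<^sup>2)\<bar> + real (n - k\<^sup>2)"
      by simp
    also have "\<dots> \<le> \<bar>s (k\<^sup>2)\<bar> + 2 * real k"
      using \<open>n - k\<^sup>2 \<le> 2 * k\<close> by linarith
    finally have "\<bar>s n\<bar> / real n \<le> (\<bar>s (k\<^sup>2)\<bar> + 2 * real k) / real n"
      by (simp add: divide_right_mono)
    also have "\<dots> \<le> (\<bar>s (k\<^sup>2)\<bar> + 2 * real k) / real (k\<^sup>2)"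
      using \<open>k > 0\<close> \<open>k\<^sup>2 \<le> n\<close> elim by (intro divide_left_mono) auto
    also have "\<dots> = b k"
      using \<open>k > 0\<close> by (simp add: b_def add_divide_distrib power2_eq_square abs_divide)
    finally show ?case by (simp add: s_def k_def abs_divide)
  qed
qed

text \<open>The squares of the averages at the times \<open>k\<^sup>2\<close> have expectations \<open>O(1 / k\<^sup>2)\<close>. Their series
  therefore has a finite expectation and converges almost surely; in particular its terms tend
  to \<open>0\<close>.\<close>

lemma (in prob_space) strong_law_if_variance_linear:
  fixes Y :: "nat \<Rightarrow> 'a \<Rightarrow> real"
  assumes meas: "\<And>i. i \<ge> 1 \<Longrightarrow> Y i \<in> borel_measurable M"
    and bounded: "\<And>i \<omega>. \<bar>Y i \<omega>\<bar> \<le> 1"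
    and variance: "\<And>n. expectation (\<lambda>\<omega>. (\<Sum>i=1..n. Y i \<omega>)\<^sup>2) \<le> K * real n"
  shows "AE \<omega> in M. (\<lambda>n. (\<Sum>i=1..n. Y i \<omega>) / real n) \<longlonglongrightarrow> 0"
proof -
  define S where "S n \<omega> = (\<Sum>i=1..n. Y i \<omega>)" for n \<omega>
  have S_meas [measurable]: "S n \<in> borel_measurable M" for n
    unfolding S_def by (intro borel_measurable_sum meas) auto
  have S_bound: "\<bar>S n \<omega>\<bar> \<le> real n" for n \<omega>
    using order.trans[OF sum_abs sum_mono[of "{1..n}" "\<lambda>i. \<bar>Y i \<omega>\<bar>" "\<lambda>_. 1"]] bounded
    by (simp add: S_def)
  have S2_int: "integrable M (\<lambda>\<omega>. (S n \<omega>)\<^sup>2)" for n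
    by (rule integrable_const_bound[of _ "(real n)\<^sup>2"])
       (use S_bound[of n] in \<open>auto simp: abs_le_square_iff[symmetric]\<close>)
  define Z where "Z k \<omega> = (S (k\<^sup>2) \<omega> / real (k\<^sup>2))\<^sup>2" for k \<omega>
  have [measurable]: "Z k \<in> borel_measurable M" for k
    unfolding Z_def by measurable
  have Z_int: "(\<integral>\<^sup>+\<omega>. ennreal (Z k \<omega>) \<partial>M) \<le> ennreal (\<bar>K\<bar> * (1 / (real k)\<^sup>2))" for k
  proof -
    have "(\<integral>\<^sup>+\<omega>. ennreal (Z k \<omega>) \<partial>M) = ennreal (expectation (Z k))"
      unfolding Z_def power_divide
      by (intro nn_integral_eq_integral) (use S2_int in auto)
    also have "expectation (Z k) = expectation (\<lambda>\<omega>. (S (k\<^sup>2) \<omega>)\<^sup>2) / (real (k\<^sup>2))\<^sup>2"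
      unfolding Z_def power_divide by simp
    also have "\<dots> \<le> (K * real (k\<^sup>2)) / (real (k\<^sup>2))\<^sup>2"
      by (intro divide_right_mono) (use variance[of "k\<^sup>2"] in \<open>auto simp: S_def\<close>)
    also have "\<dots> \<le> (\<bar>K\<bar> * real (k\<^sup>2)) / (real (k\<^sup>2))\<^sup>2"
      by (intro divide_right_mono mult_right_mono) auto
    also have "\<dots> = \<bar>K\<bar> * (1 / (real k)\<^sup>2)"
      by (simp add: power2_eq_square)
    finally show ?thesis by (simp add: ennreal_leI)
  qed
  have "summable (\<lambda>k. 1 / (real k)\<^sup>2)"
    using inverse_power_summable[of 2, where ?'a = real] by (simp add: field_simps)
  hence fin: "(\<Sum>k. ennreal (\<bar>K\<bar> * (1 / (real k)\<^sup>2))) \<noteq> top"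
    using summable_mult[of "\<lambda>k. 1 / (real k)\<^sup>2" "\<bar>K\<bar>"] by (subst suminf_ennreal2) auto
  have "(\<integral>\<^sup>+\<omega>. (\<Sum>k. ennreal (Z k \<omega>)) \<partial>M) = (\<Sum>k. \<integral>\<^sup>+\<omega>. ennreal (Z k \<omega>) \<partial>M)"
    by (intro nn_integral_suminf) auto
  also have "\<dots> \<le> (\<Sum>k. ennreal (\<bar>K\<bar> * (1 / (real k)\<^sup>2)))"
    by (intro suminf_le Z_int) auto
  finally have "(\<integral>\<^sup>+\<omega>. (\<Sum>k. ennreal (Z k \<omega>)) \<partial>M) \<noteq> \<infinity>"
    using fin by (auto simp: top_unique)
  hence "AE \<omega> in M. (\<Sum>k. ennreal (Z k \<omega>)) \<noteq> \<infinity>"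
    by (intro nn_integral_noteq_infinite) auto
  thus ?thesis
  proof eventually_elim
    case (elim \<omega>)
    hence "summable (\<lambda>k. Z k \<omega>)"
      by (intro summable_suminf_not_top) (auto simp: Z_def)
    hence "(\<lambda>k. sqrt (Z k \<omega>)) \<longlonglongrightarrow> 0"
      using tendsto_real_sqrt[OF summable_LIMSEQ_zero] by fastforce
    hence "(\<lambda>k. S (k\<^sup>2) \<omega> / real (k\<^sup>2)) \<longlonglongrightarrow> 0"
      unfolding Z_def real_sqrt_abs tendsto_rabs_zero_iff .
    thus ?case
      unfolding S_def by (intro averages_converge_if_along_squares bounded)
  qed
qed

section \<open>Strong mixing\<close>

text \<open>The suprema in the mixing coefficients are taken over sets bounded by \<open>1\<close>; without an upper
  bound the real-valued supremum would carry no information about its members.\<close>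

lemma (in prob_space) abs_prob_diff_le_1:
  "\<bar>prob A * prob B - prob (A \<inter> B)\<bar> \<le> 1"
proof -
  have "0 \<le> prob A * prob B" "prob A * prob B \<le> 1"
    by (auto intro!: mult_le_one)
  moreover have "0 \<le> prob (A \<inter> B)" "prob (A \<inter> B) \<le> 1"
    by auto
  ultimately show ?thesis by linarith
qed

lemma (in prob_space) abs_prob_diff_le_alpha_coeff:
  assumes "A \<in> \<A>" "B \<in> \<B>"
  shows "\<bar>prob A * prob B - prob (A \<inter> B)\<bar> \<le> alpha_coeff M \<A> \<B>"
proof -
  have "bdd_above ((\<lambda>(A, B). \<bar>prob A * prob B - prob (A \<inter> B)\<bar>) ` (\<A> \<times> \<B>))"
    by (rule bdd_aboveI2[of _ _ 1]) (auto simp: abs_prob_diff_le_1)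
  from cSUP_upper[OF _ this, of "(A, B)"] show ?thesis
    using assms by (simp add: alpha_coeff_def)
qed

lemma generated_sigma_contains:
  assumes "i \<in> I" "A \<in> sets borel"
  shows "X i -` A \<inter> space M \<in> generated_sigma M X I"
  unfolding generated_sigma_def using assms by (intro sigma_sets.Basic) auto

lemma (in prob_space) alpha_coeff_le_1:
  "alpha_coeff M (generated_sigma M X I) (generated_sigma M X J) \<le> 1"
  unfolding alpha_coeff_def
  by (rule cSUP_least)
     (auto simp: generated_sigma_def intro: sigma_sets.Empty abs_prob_diff_le_1)

text \<open>The coefficient at \<open>j - i\<close> bounds this pair because time \<open>i\<close> may be taken as the end of the
  past, which makes \<open>j = (j - i) + i\<close> the start of the future.\<close>

lemma (in prob_space) abs_prob_diff_le_strong_mixing_coeff: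
  assumes "1 \<le> i" "i < j" and A: "A \<in> sets borel" "B \<in> sets borel"
  shows "\<bar>prob (X i -` A \<inter> space M) * prob (X j -` B \<inter> space M)
            - prob ((X i -` A \<inter> space M) \<inter> (X j -` B \<inter> space M))\<bar>
         \<le> strong_mixing_coeff M X (j - i)"
proof -
  have "\<bar>prob (X i -` A \<inter> space M) * prob (X j -` B \<inter> space M)
            - prob ((X i -` A \<inter> space M) \<inter> (X j -` B \<inter> space M))\<bar>
        \<le> alpha_coeff M (generated_sigma M X {1..i}) (generated_sigma M X {(j - i) + i..})"
    using assms by (intro abs_prob_diff_le_alpha_coeff generated_sigma_contains) auto
  also have "\<dots> \<le> strong_mixing_coeff M X (j - i)"
    unfolding strong_mixing_coeff_def
    using \<open>1 \<le> i\<close> by (intro cSUP_upper) (auto intro!: bdd_aboveI2[of _ _ 1] alpha_coeff_le_1)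
  finally show ?thesis .
qed

lemma (in prob_space) strong_mixing_coeff_nonneg: "0 \<le> strong_mixing_coeff M X n"
proof -
  have empty: "{} \<in> generated_sigma M X I" for I
    by (simp add: generated_sigma_def sigma_sets.Empty)
  have "0 \<le> alpha_coeff M (generated_sigma M X {1..1}) (generated_sigma M X {n + 1..})"
    using abs_prob_diff_le_alpha_coeff[OF empty empty] by fastforce
  also have "\<dots> \<le> strong_mixing_coeff M X n"
    unfolding strong_mixing_coeff_def
    by (intro cSUP_upper) (auto intro!: bdd_aboveI2[of _ _ 1] alpha_coeff_le_1)
  finally show ?thesis .
qed

section \<open>Convergence of empirical frequencies\<close>

text \<open>One-dimensional case of stationarity: the index set \<open>{1}\<close>, shifted by \<open>i - 1\<close>.\<close>

lemma stationary_process_marginal: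
  assumes "stationary_process M X" and "\<And>j. j \<ge> 1 \<Longrightarrow> X j \<in> borel_measurable M"
    and "i \<ge> 1" and "A \<in> sets borel"
  shows "measure M (X i -` A \<inter> space M) = measure M (X 1 -` A \<inter> space M)"
proof -
  have marginal: "measure (distr M (PiM {1} (\<lambda>_. borel)) (\<lambda>\<omega>. \<lambda>j\<in>{1}. X (j + h) \<omega>))
                    {f \<in> space (PiM {1} (\<lambda>_. borel)). f 1 \<in> A}
                  = measure M (X (1 + h) -` A \<inter> space M)" for h
  proof -
    have "(\<lambda>\<omega>. \<lambda>j\<in>{1}. X (j + h) \<omega>) \<in> measurable M (PiM {1} (\<lambda>_. borel))"
      by (rule measurable_restrict) (use assms(2) in auto)
    moreover have "{f \<in> space (PiM {1} (\<lambda>_. borel)). f 1 \<in> A} \<in> sets (PiM {1::nat} (\<lambda>_. borel))"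
      using assms(4) by measurable
    ultimately have "measure (distr M (PiM {1} (\<lambda>_. borel)) (\<lambda>\<omega>. \<lambda>j\<in>{1}. X (j + h) \<omega>))
                    {f \<in> space (PiM {1} (\<lambda>_. borel)). f 1 \<in> A}
        = measure M ((\<lambda>\<omega>. \<lambda>j\<in>{1}. X (j + h) \<omega>) -` {f \<in> space (PiM {1} (\<lambda>_. borel)). f 1 \<in> A} \<inter> space M)"
      by (rule measure_distr)
    also have "(\<lambda>\<omega>. \<lambda>j\<in>{1}. X (j + h) \<omega>) -` {f \<in> space (PiM {1} (\<lambda>_. borel)). f 1 \<in> A} \<inter> space M
        = X (1 + h) -` A \<inter> space M"
      by (auto simp: space_PiM)
    finally show ?thesis .
  qed
  have "distr M (PiM {1} (\<lambda>_. borel)) (\<lambda>\<omega>. \<lambda>j\<in>{1}. X (j + (i - 1)) \<omega>) =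
        distr M (PiM {1} (\<lambda>_. borel)) (\<lambda>\<omega>. \<lambda>j\<in>{1}. X j \<omega>)"
    using assms(1) unfolding stationary_process_def by simp
  thus ?thesis
    using marginal[of "i - 1"] marginal[of 0] \<open>i \<ge> 1\<close> by simp
qed

text \<open>Adding the term with index \<open>n + 1\<close> increases the second moment by its own square, at most
  \<open>1\<close>, and by twice its products with the earlier terms, at most \<open>2 * (a 1 + \<dots> + a n)\<close>. This
  increment is bounded independently of \<open>n\<close>.\<close>

lemma (in prob_space) variance_partial_sum_le:
  fixes Y :: "nat \<Rightarrow> 'a \<Rightarrow> real"
  assumes meas: "\<And>i. i \<ge> 1 \<Longrightarrow> Y i \<in> borel_measurable M"
    and bounded: "\<And>i \<omega>. \<bar>Y i \<omega>\<bar> \<le> 1"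
    and cov: "\<And>i j. \<lbrakk>1 \<le> i; i < j\<rbrakk> \<Longrightarrow> expectation (\<lambda>\<omega>. Y i \<omega> * Y j \<omega>) \<le> a (j - i)"
    and a: "summable a" "\<And>n. 0 \<le> a n"
  shows "expectation (\<lambda>\<omega>. (\<Sum>i=1..n. Y i \<omega>)\<^sup>2) \<le> (1 + 2 * suminf a) * real n"
proof (induction n)
  case (Suc n)
  have Y_int: "integrable M (\<lambda>\<omega>. Y i \<omega> * Y j \<omega>)" if "i \<ge> 1" "j \<ge> 1" for i j
    using meas[OF that(1)] meas[OF that(2)] bounded
    by (intro integrable_const_bound[of _ 1]) (auto simp: abs_mult intro!: mult_le_one)
  have sq_eq: "(\<Sum>i=1..n. Y i \<omega>)\<^sup>2 = (\<Sum>i=1..n. \<Sum>j=1..n. Y i \<omega> * Y j \<omega>)" for \<omega>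
    by (simp add: power2_eq_square sum_product)
  have sq_int: "integrable M (\<lambda>\<omega>. (\<Sum>i=1..n. Y i \<omega>)\<^sup>2)"
    unfolding sq_eq by (intro Bochner_Integration.integrable_sum Y_int) auto
  have "(\<Sum>i=1..Suc n. Y i \<omega>)\<^sup>2 = (\<Sum>i=1..n. Y i \<omega>)\<^sup>2
          + (2 * (\<Sum>i=1..n. Y i \<omega> * Y (Suc n) \<omega>) + Y (Suc n) \<omega> * Y (Suc n) \<omega>)" for \<omega>
    by (simp add: power2_sum sum_distrib_right[symmetric] power2_eq_square algebra_simps)
  moreover have "expectation (\<lambda>\<omega>. \<Sum>i=1..n. Y i \<omega> * Y (Suc n) \<omega>)
          = (\<Sum>i=1..n. expectation (\<lambda>\<omega>. Y i \<omega> * Y (Suc n) \<omega>))"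
    by (intro Bochner_Integration.integral_sum Y_int) auto
  moreover have "integrable M (\<lambda>\<omega>. \<Sum>i=1..n. Y i \<omega> * Y (Suc n) \<omega>)"
    by (intro Bochner_Integration.integrable_sum Y_int) auto
  ultimately have "expectation (\<lambda>\<omega>. (\<Sum>i=1..Suc n. Y i \<omega>)\<^sup>2) = expectation (\<lambda>\<omega>. (\<Sum>i=1..n. Y i \<omega>)\<^sup>2)
          + (2 * (\<Sum>i=1..n. expectation (\<lambda>\<omega>. Y i \<omega> * Y (Suc n) \<omega>))
             + expectation (\<lambda>\<omega>. Y (Suc n) \<omega> * Y (Suc n) \<omega>))"
    using sq_int Y_int[of "Suc n" "Suc n"] by simp
  also have "(\<Sum>i=1..n. expectation (\<lambda>\<omega>. Y i \<omega> * Y (Suc n) \<omega>)) \<le> (\<Sum>i=1..n. a (Suc n - i))"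
    by (intro sum_mono cov) auto
  also have "(\<Sum>i=1..n. a (Suc n - i)) = (\<Sum>d=1..n. a d)"
    by (rule sum.reindex_bij_witness[of _ "\<lambda>d. Suc n - d" "\<lambda>i. Suc n - i"]) auto
  also have "\<dots> \<le> suminf a"
    using a by (intro sum_le_suminf) auto
  also have "expectation (\<lambda>\<omega>. Y (Suc n) \<omega> * Y (Suc n) \<omega>) \<le> 1"
    using Y_int[of "Suc n" "Suc n"] bounded[of "Suc n"]
    by (intro integral_le_const AE_I2) (auto simp: abs_le_square_iff[of _ 1, simplified, symmetric] power2_eq_square[symmetric])
  finally show ?case
    using Suc.IH by (simp add: algebra_simps)
qed auto

text \<open>The centred indicators are bounded by \<open>1\<close>, and mixing bounds their covariances by a summable
  function of the time lag.\<close>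

lemma (in prob_space) strong_law_frequency:
  fixes X :: "nat \<Rightarrow> 'a \<Rightarrow> real"
  assumes meas: "\<And>j. j \<ge> 1 \<Longrightarrow> X j \<in> borel_measurable M"
    and stat: "stationary_process M X"
    and mixing: "summable (strong_mixing_coeff M X)"
    and A: "A \<in> sets borel"
  shows "AE \<omega> in M. (\<lambda>n. frequency X n \<omega> A) \<longlonglongrightarrow> measure (distr M borel (X 1)) A"
proof -
  define E where "E i = X i -` A \<inter> space M" for i
  define p where "p = measure (distr M borel (X 1)) A"
  define Y where "Y i \<omega> = indicator A (X i \<omega>) - p" for i \<omega>
  have E_sets [measurable]: "E i \<in> events" if "i \<ge> 1" for i
    unfolding E_def using meas[OF that] A by (rule measurable_sets)
  have prob_E: "prob (E i) = p" if "i \<ge> 1" for i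
    unfolding E_def p_def using stationary_process_marginal[OF stat meas that A] meas[of 1] A
    by (simp add: measure_distr)
  have "0 \<le> p" "p \<le> 1"
    using prob_E[of 1] by (metis measure_nonneg order_refl, metis prob_le_1 order_refl)
  have Y_eq: "Y i \<omega> = indicator (E i) \<omega> - p" if "\<omega> \<in> space M" for i \<omega>
    using that by (auto simp: Y_def E_def indicator_def)
  have cov: "expectation (\<lambda>\<omega>. Y i \<omega> * Y j \<omega>) \<le> strong_mixing_coeff M X (j - i)"
    if "1 \<le> i" "i < j" for i j
  proof -
    have [measurable]: "E i \<in> events" "E j \<in> events"
      using that by (auto intro: E_sets)
    have "expectation (\<lambda>\<omega>. Y i \<omega> * Y j \<omega>)
        = expectation (\<lambda>\<omega>. indicator (E i \<inter> E j) \<omega> - p * indicator (E i) \<omega> - p * indicator (E j) \<omega> + p * p)"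
      by (intro Bochner_Integration.integral_cong refl)
         (simp add: Y_eq algebra_simps indicator_inter_arith)
    also have "\<dots> = prob (E i \<inter> E j) - p * prob (E i) - p * prob (E j) + p * p"
    proof -
      have [simp]: "integrable M (indicator B :: 'a \<Rightarrow> real)" if "B \<in> events" for B
        using that by (intro integrable_real_indicator) (simp_all add: emeasure_eq_measure)
      show ?thesis
        by (simp add: prob_space sets.Int)
    qed
    also have "\<dots> = prob (E i \<inter> E j) - prob (E i) * prob (E j)"
      using that by (simp add: prob_E)
    also have "\<dots> \<le> strong_mixing_coeff M X (j - i)"
      using abs_prob_diff_le_strong_mixing_coeff[OF that A A, of X] by (simp add: E_def abs_le_iff)
    finally show ?thesis .
  qed
  have Y_meas: "Y i \<in> borel_measurable M" if "i \<ge> 1" for i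
    using meas[OF that] A unfolding Y_def by measurable
  have Y_bounded: "\<bar>Y i \<omega>\<bar> \<le> 1" for i \<omega>
    using \<open>0 \<le> p\<close> \<open>p \<le> 1\<close> by (auto simp: Y_def indicator_def)
  have "AE \<omega> in M. (\<lambda>n. (\<Sum>i=1..n. Y i \<omega>) / real n) \<longlonglongrightarrow> 0"
    using Y_meas Y_bounded
      variance_partial_sum_le[OF Y_meas Y_bounded cov mixing strong_mixing_coeff_nonneg]
    by (rule strong_law_if_variance_linear)
  thus ?thesis
  proof eventually_elim
    case (elim \<omega>)
    have "\<forall>\<^sub>F n in sequentially. (\<Sum>i=1..n. Y i \<omega>) / real n = frequency X n \<omega> A - p"
      using eventually_gt_at_top[of 0]
      by eventually_elim (simp add: Y_def frequency_def sum_subtractf diff_divide_distrib)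
    with elim have "(\<lambda>n. frequency X n \<omega> A - p) \<longlonglongrightarrow> 0"
      by (simp cong: tendsto_cong)
    thus ?case by (simp add: p_def LIM_zero_iff)
  qed
qed

section \<open>The Glivenko-Cantelli theorem under strong mixing\<close>

theorem proposition1:
  fixes M :: "'a measure" and X :: "nat \<Rightarrow> 'a \<Rightarrow> real" and F :: "real \<Rightarrow> real" and \<delta> :: real
  assumes "prob_space M"
    and "\<And>j. j \<ge> 1 \<Longrightarrow> X j \<in> borel_measurable M"
    and "stationary_process M X"
    and "\<And>j. j \<ge> 1 \<Longrightarrow> integrable M (\<lambda>\<omega>. (X j \<omega>)\<^sup>2)"
    and "alpha_mixing M X"
    and "F = cdf (distr M borel (X 1))"
    and "0 < \<delta>" and "\<delta> < 1"
    and "strong_mixing_coeff M X \<in> O(\<lambda>n. real n powr (- ((1 + \<delta>) / (1 - \<delta>))))"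
  shows "AE \<omega> in M. (\<lambda>n. SUP x. \<bar>empirical_cdf X n \<omega> x - F x\<bar>) \<longlonglongrightarrow> 0"
proof -
  interpret prob_space M by fact
  let ?\<mu> = "distr M borel (X 1)"
  interpret \<mu>: cdf_distribution ?\<mu>
    unfolding cdf_distribution_def using assms(2)[of 1] by (intro real_distribution_distr) auto
  have "- ((1 + \<delta>) / (1 - \<delta>)) < -1"
    using assms(7,8) by (simp add: field_simps)
  hence mixing: "summable (strong_mixing_coeff M X)"
    by (intro summable_comparison_test_bigo[OF _ assms(9)]) (simp add: summable_real_powr_iff)
  have "AE \<omega> in M. \<forall>t\<in>\<rat>. (\<lambda>n. frequency X n \<omega> {..\<mu>.I t}) \<longlonglongrightarrow> measure ?\<mu> {..\<mu>.I t}"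
    by (subst AE_ball_countable[OF countable_rat])
       (intro ballI strong_law_frequency assms(2,3) mixing, simp_all)
  moreover have "AE \<omega> in M. \<forall>t\<in>\<rat>. (\<lambda>n. frequency X n \<omega> {..<\<mu>.I t}) \<longlonglongrightarrow> measure ?\<mu> {..<\<mu>.I t}"
    by (subst AE_ball_countable[OF countable_rat])
       (intro ballI strong_law_frequency assms(2,3) mixing, simp_all)
  ultimately have "AE \<omega> in M. (\<lambda>n. SUP x. \<bar>frequency X n \<omega> {..x} - F x\<bar>) \<longlonglongrightarrow> 0"
  proof eventually_elim
    case (elim \<omega>)
    thus ?case unfolding assms(6)
      by (intro \<mu>.uniform_convergence_from_quantiles frequency_nonneg frequency_le_1 frequency_mono) auto
  qed
  thus ?thesis by (simp add: empirical_cdf_def frequency_def)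
qed

end
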